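(* Let $\eta>0$ and let $S\subseteq\mathcal U$ be an $\eta$-separating design, i.e. $\Delta(S)\ge\eta$. Then, for every prior $b_0$ on $[M]$ (with $b_0(i)>0$ for all $i$) and every $\delta\in(0,1)$, $$V_\delta(\gamma_S;b_0)\;\le\;(M-1)\left\lceil \frac{8}{\eta^2}\log\frac{M-1}{\delta}\right\rceil .$$
   Context: Fix an integer $M\ge 2$ and write $[M]=\{1,\dots,M\}$. All logarithms are natural. Model. $(\mathcal A,\mathscr A)$ is a measurable space of evaluations and $(\mathsf Y,\mathcal Y)$ a measurable response space. For each $i\in[M]$, $P_i$ is a Markov kernel from $(\mathcal A,\mathscr A)$ to $(\mathsf Y,\mathcal Y)$, and $P_i^a(B):=P_i(a,B)$. A prior is a probability vector $b_0$ on $[M]$ with $b_0(i)>0$ for all $i$; the unknown index $I^\star$ is drawn from $b_0$. At each time $t\ge1$ the evaluator picks $A_t\in\mathcal A$ from the history $H_{t-1}=((A_1,Y_1),\dots,(A_{t-1},Y_{t-1}))$ ($H_0=\varnothing$) and then observes $Y_t$; $\mathcal F_t:=\sigma(H_t)$. A policy $\pi=(\pi_t)_{t\ge1}$ is a sequence of probability kernels with $\mathbb P(A_t\in C\mid\mathcal F_{t-1})=\pi_t(C\mid H_{t-1})$ a.s. for all $C\in\mathscr A$. Responses satisfy $\mathbb P(Y_t\in B\mid I^\star=i,\mathcal F_{t-1},A_t)=P_i^{A_t}(B)$ a.s. for all $i\in[M]$, $B\in\mathcal Y$. $\mathbb P_{b_0}^\pi,\mathbb E_{b_0}^\pi$ denote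 probability and expectation under the induced law. For $a\in\mathcal A$ let $\mu^a:=\sum_{i=1}^M P_i^a$; it is assumed that the densities $p_i^a(y)=\frac{dP_i^a}{d\mu^a}(y)$ have versions jointly measurable in $(a,y)$. Modules and designs. $\mathcal U$ is a finite nonempty collection of probe modules; each $u\in\mathcal U$ has a construction cost $\kappa_u>0$ and a nonempty finite (measurable) set of evaluations $\mathcal A_u\subseteq\mathcal A$. A design is a subset $S\subseteq\mathcal U$; $\mathcal A_S:=\bigcup_{u\in S}\mathcal A_u$, and $\gamma_S$ denotes the design with available action set $\mathcal A_S$. Inner value. For $\delta\in(0,1)$, an admissible procedure under $\gamma_S$ consists of a policy $\pi$ supported on $\mathcal A_S$ (all actions lie in $\mathcal A_S$), an almost surely finite stopping time $\tau$ (with respect to $(\mathcal F_t)$), and an $\mathcal F_\tau$-measurable estimate $\widehat I\in[M]$. Define $$V_\delta(\gamma_S;b_0):=\inf_{\pi,\tau,\widehat I}\mathbb E_{b_0}^\pi[\tau]\quad\text{subject to}\quad \mathbb P_{b_0}^\pi(\widehat I\ne I^\star)\le\delta,$$ with the infimum over an empty feasible set equal to $+\infty$. Summaries and separation. $K\ge1$ is an integer, and for each evaluation $a$ there is a fixed measurable summary $\varphi_a:\mathsf Y\to[K]$. $Q_i^a$ denotes the law of $\varphi_a(Y)$ on $[K]$ when $Y\sim P_i^a$ (the pushforward of $P_i^a$ under $\varphi_a$). Let $\mathcal J:=\{(i,j):1\le i<j\le M\}$. For a design $S$, $$\Delta(S):=\min_{(i,j)\in\mathcal J}\ \max_{a\in\mathcal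 A_S}\|Q_i^a-Q_j^a\|_1,$$ where the maximum over an empty set is $0$. $S$ is called $\eta$-separating if $\Delta(S)\ge\eta$. *)

theory Defs
  imports "HOL-Probability.Probability"
begin

text \<open>
  Evaluations form the measurable space \<open>A\<close> and responses the measurable space \<open>Y\<close>; of a value of
  type \<^typ>\<open>'a measure\<close> used in this role only the underlying set and the sigma-algebra matter.
  Rounds are counted from 0: coordinate \<open>t\<close> of a trajectory is the pair of the action and the
  response of round \<open>t + 1\<close>, and the history \<open>H\<^sub>t\<close> of the first \<open>t\<close> rounds is a point of
  \<open>PiM {0..<t} (\<lambda>_. A \<Otimes>\<^sub>M Y)\<close>. Accordingly \<open>\<pi> t\<close> is the kernel that chooses the action of
  round \<open>t + 1\<close>.
\<close>

definition is_policy ::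
  "'a measure \<Rightarrow> 'y measure \<Rightarrow> (nat \<Rightarrow> (nat \<Rightarrow> 'a \<times> 'y) \<Rightarrow> 'a measure) \<Rightarrow> bool"
where
  "is_policy A Y \<pi> \<longleftrightarrow> (\<forall>t. \<pi> t \<in> PiM {0..<t} (\<lambda>_. A \<Otimes>\<^sub>M Y) \<rightarrow>\<^sub>M prob_algebra A)"

definition supported_on ::
  "'a measure \<Rightarrow> 'y measure \<Rightarrow> (nat \<Rightarrow> (nat \<Rightarrow> 'a \<times> 'y) \<Rightarrow> 'a measure) \<Rightarrow> 'a set \<Rightarrow> bool"
where
  "supported_on A Y \<pi> C \<longleftrightarrow>
     (\<forall>t. \<forall>h\<in>space (PiM {0..<t} (\<lambda>_. A \<Otimes>\<^sub>M Y)). measure (\<pi> t h) C = 1)"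

text \<open>One round under the response kernel \<open>R\<close>: an action drawn from the policy, then a response.\<close>

definition round_kernel ::
  "'a measure \<Rightarrow> 'y measure \<Rightarrow> ('a \<Rightarrow> 'y measure) \<Rightarrow> (nat \<Rightarrow> (nat \<Rightarrow> 'a \<times> 'y) \<Rightarrow> 'a measure) \<Rightarrow>
    nat \<Rightarrow> (nat \<Rightarrow> 'a \<times> 'y) \<Rightarrow> ('a \<times> 'y) measure"
where
  "round_kernel A Y R \<pi> t h = \<pi> t h \<bind> (\<lambda>a. distr (R a) (A \<Otimes>\<^sub>M Y) (Pair a))"

text \<open>The Ionescu-Tulcea law of the whole sequence of actions and responses; it is the law of the
  trajectory conditionally on the value \<open>i\<close> of the unknown index when \<open>R = P i\<close>.\<close>

definition trajectory_law ::
  "'a measure \<Rightarrow> 'y measure \<Rightarrow> ('a \<Rightarrow> 'y measure) \<Rightarrow> (nat \<Rightarrow> (nat \<Rightarrow> 'a \<times> 'y) \<Rightarrow> 'a measure) \<Rightarrow>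
    (nat \<Rightarrow> 'a \<times> 'y) measure"
where
  "trajectory_law A Y R \<pi> =
     projective_family.lim UNIV
       (Ionescu_Tulcea.CI (round_kernel A Y R \<pi>) (\<lambda>_. A \<Otimes>\<^sub>M Y)) (\<lambda>_. A \<Otimes>\<^sub>M Y)"

text \<open>Outcomes are pairs of the unknown index \<open>I\<^sup>\<star>\<close> (so \<open>I\<^sup>\<star> = fst\<close>) and a trajectory.\<close>

definition outcome_space :: "nat \<Rightarrow> 'a measure \<Rightarrow> 'y measure \<Rightarrow> (nat \<times> (nat \<Rightarrow> 'a \<times> 'y)) measure"
where
  "outcome_space M A Y = count_space {1..M} \<Otimes>\<^sub>M PiM UNIV (\<lambda>_. A \<Otimes>\<^sub>M Y)"

definition outcome_law ::
  "nat \<Rightarrow> 'a measure \<Rightarrow> 'y measure \<Rightarrow> (nat \<Rightarrow> 'a \<Rightarrow> 'y measure) \<Rightarrow> (nat \<Rightarrow> real) \<Rightarrow>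
    (nat \<Rightarrow> (nat \<Rightarrow> 'a \<times> 'y) \<Rightarrow> 'a measure) \<Rightarrow> (nat \<times> (nat \<Rightarrow> 'a \<times> 'y)) measure"
where
  "outcome_law M A Y P b0 \<pi> =
     point_measure {1..M} (\<lambda>i. ennreal (b0 i)) \<bind>
       (\<lambda>i. distr (trajectory_law A Y (P i) \<pi>) (outcome_space M A Y) (Pair i))"

text \<open>The filtration generated by the histories. Stopping times take values in \<^typ>\<open>enat\<close>, hence
  the filtration is indexed by \<^typ>\<open>enat\<close>; its value at \<open>\<infinity>\<close> is the sigma-algebra generated by the
  whole trajectory. No \<open>\<F> t\<close> contains information on the unknown index.\<close>

definition history_filtration ::
  "nat \<Rightarrow> 'a measure \<Rightarrow> 'y measure \<Rightarrow> enat \<Rightarrow> (nat \<times> (nat \<Rightarrow> 'a \<times> 'y)) measure"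
where
  "history_filtration M A Y t =
     vimage_algebra (space (outcome_space M A Y))
       (\<lambda>\<omega>. restrict (snd \<omega>) {s. enat s < t}) (PiM {s. enat s < t} (\<lambda>_. A \<Otimes>\<^sub>M Y))"

definition admissible ::
  "nat \<Rightarrow> 'a measure \<Rightarrow> 'y measure \<Rightarrow> (nat \<Rightarrow> 'a \<Rightarrow> 'y measure) \<Rightarrow> (nat \<Rightarrow> real) \<Rightarrow> 'a set \<Rightarrow>
    (nat \<Rightarrow> (nat \<Rightarrow> 'a \<times> 'y) \<Rightarrow> 'a measure) \<Rightarrow> (nat \<times> (nat \<Rightarrow> 'a \<times> 'y) \<Rightarrow> enat) \<Rightarrow>
    (nat \<times> (nat \<Rightarrow> 'a \<times> 'y) \<Rightarrow> nat) \<Rightarrow> bool"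
where
  "admissible M A Y P b0 C \<pi> \<tau> I \<longleftrightarrow>
     is_policy A Y \<pi> \<and> supported_on A Y \<pi> C \<and>
     stopping_time (history_filtration M A Y) \<tau> \<and>
     (AE \<omega> in outcome_law M A Y P b0 \<pi>. \<tau> \<omega> < \<infinity>) \<and>
     I \<in> filtration.pre_sigma (space (outcome_space M A Y)) (history_filtration M A Y) \<tau>
           \<rightarrow>\<^sub>M count_space {1..M}"

text \<open>\<open>inner_value M A Y P b0 C \<delta>\<close> is the inner value of a design with available action set \<open>C\<close>; the
  infimum of the empty set in \<^typ>\<open>ennreal\<close> is \<open>\<infinity>\<close>.\<close>

definition inner_value ::
  "nat \<Rightarrow> 'a measure \<Rightarrow> 'y measure \<Rightarrow> (nat \<Rightarrow> 'a \<Rightarrow> 'y measure) \<Rightarrow> (nat \<Rightarrow> real) \<Rightarrow> 'a set \<Rightarrow>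
    real \<Rightarrow> ennreal"
where
  "inner_value M A Y P b0 C \<delta> =
     Inf {\<integral>\<^sup>+ \<omega>. ennreal_of_enat (\<tau> \<omega>) \<partial>outcome_law M A Y P b0 \<pi> | \<pi> \<tau> I.
            admissible M A Y P b0 C \<pi> \<tau> I \<and>
            measure (outcome_law M A Y P b0 \<pi>) {\<omega> \<in> space (outcome_space M A Y). I \<omega> \<noteq> fst \<omega>} \<le> \<delta>}"

text \<open>The reference measure \<open>\<mu>\<^sup>a\<close>, the sum of the response laws at \<open>a\<close>.\<close>

definition dominating_measure ::
  "nat \<Rightarrow> 'y measure \<Rightarrow> (nat \<Rightarrow> 'a \<Rightarrow> 'y measure) \<Rightarrow> 'a \<Rightarrow> 'y measure"
where
  "dominating_measure M Y P a =
     measure_of (space Y) (sets Y) (\<lambda>B. \<Sum>i\<in>{1..M}. emeasure (P i a) B)"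

definition jointly_measurable_densities ::
  "nat \<Rightarrow> 'a measure \<Rightarrow> 'y measure \<Rightarrow> (nat \<Rightarrow> 'a \<Rightarrow> 'y measure) \<Rightarrow> bool"
where
  "jointly_measurable_densities M A Y P \<longleftrightarrow>
     (\<exists>p :: nat \<Rightarrow> 'a \<Rightarrow> 'y \<Rightarrow> ennreal. \<forall>i\<in>{1..M}.
        (\<lambda>(a, y). p i a y) \<in> borel_measurable (A \<Otimes>\<^sub>M Y) \<and>
        (\<forall>a\<in>space A. P i a = density (dominating_measure M Y P a) (p i a)))"

definition summary_law ::
  "nat \<Rightarrow> (nat \<Rightarrow> 'a \<Rightarrow> 'y measure) \<Rightarrow> ('a \<Rightarrow> 'y \<Rightarrow> nat) \<Rightarrow> nat \<Rightarrow> 'a \<Rightarrow> nat measure"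
where
  "summary_law K P \<phi> i a = distr (P i a) (count_space {1..K}) (\<phi> a)"

definition l1_dist :: "nat \<Rightarrow> nat measure \<Rightarrow> nat measure \<Rightarrow> real"
where
  "l1_dist K Q Q' = (\<Sum>k\<in>{1..K}. \<bar>measure Q {k} - measure Q' {k}\<bar>)"

definition design_actions :: "('u \<Rightarrow> 'a set) \<Rightarrow> 'u set \<Rightarrow> 'a set"
where
  "design_actions Act S = (\<Union>u\<in>S. Act u)"

definition index_pairs :: "nat \<Rightarrow> (nat \<times> nat) set"
where
  "index_pairs M = {(i, j). 1 \<le> i \<and> i < j \<and> j \<le> M}"

definition separation ::
  "nat \<Rightarrow> (nat \<Rightarrow> 'a \<Rightarrow> 'y measure) \<Rightarrow> nat \<Rightarrow> ('a \<Rightarrow> 'y \<Rightarrow> nat) \<Rightarrow> ('u \<Rightarrow> 'a set) \<Rightarrow> 'u set \<Rightarrow> real"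
where
  "separation M P K \<phi> Act S =
     (MIN (i, j)\<in>index_pairs M.
        if design_actions Act S = {} then 0
        else MAX a\<in>design_actions Act S. l1_dist K (summary_law K P \<phi> i a) (summary_law K P \<phi> j a))"

text \<open>The laws above are well defined: the round kernels meet the hypotheses of the Ionescu-Tulcea
  construction, \<^const>\<open>history_filtration\<close> is a filtration, and \<^const>\<open>outcome_law\<close> is a probability
  measure on \<^const>\<open>outcome_space\<close>.\<close>

lemma measurable_round_kernel:
  assumes R: "R \<in> A \<rightarrow>\<^sub>M prob_algebra Y" and \<pi>: "is_policy A Y \<pi>"
  shows "round_kernel A Y R \<pi> t \<in> PiM {0..<t} (\<lambda>_. A \<Otimes>\<^sub>M Y) \<rightarrow>\<^sub>M prob_algebra (A \<Otimes>\<^sub>M Y)"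
proof -
  have [measurable]: "(\<lambda>a. distr (R a) (A \<Otimes>\<^sub>M Y) (Pair a)) \<in> A \<rightarrow>\<^sub>M prob_algebra (A \<Otimes>\<^sub>M Y)"
    by (rule measurable_distr_prob_space2[OF R]) simp
  have [measurable]: "\<pi> t \<in> PiM {0..<t} (\<lambda>_. A \<Otimes>\<^sub>M Y) \<rightarrow>\<^sub>M prob_algebra A"
    using \<pi> by (simp add: is_policy_def)
  show ?thesis
    unfolding round_kernel_def[abs_def] by measurable
qed

lemma Ionescu_Tulcea_round_kernel:
  assumes "R \<in> A \<rightarrow>\<^sub>M prob_algebra Y" and "is_policy A Y \<pi>"
  shows "Ionescu_Tulcea (round_kernel A Y R \<pi>) (\<lambda>_. A \<Otimes>\<^sub>M Y)"
proof (rule Ionescu_Tulcea.intro)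
  fix t
  note * = measurable_round_kernel[OF assms, of t]
  from * show "round_kernel A Y R \<pi> t \<in> PiM {0..<t} (\<lambda>_. A \<Otimes>\<^sub>M Y) \<rightarrow>\<^sub>M subprob_algebra (A \<Otimes>\<^sub>M Y)"
    by (rule measurable_prob_algebraD)
  show "prob_space (round_kernel A Y R \<pi> t h)" if "h \<in> space (PiM {0..<t} (\<lambda>_. A \<Otimes>\<^sub>M Y))" for h
    using measurable_space[OF * that] by (simp add: space_prob_algebra)
qed

lemma trajectory_law:
  assumes "R \<in> A \<rightarrow>\<^sub>M prob_algebra Y" and "is_policy A Y \<pi>"
  shows "prob_space (trajectory_law A Y R \<pi>)"
    and "sets (trajectory_law A Y R \<pi>) = sets (PiM UNIV (\<lambda>_. A \<Otimes>\<^sub>M Y))"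
proof -
  interpret Ionescu_Tulcea "round_kernel A Y R \<pi>" "\<lambda>_. A \<Otimes>\<^sub>M Y"
    by (rule Ionescu_Tulcea_round_kernel[OF assms])
  show "sets (trajectory_law A Y R \<pi>) = sets (PiM UNIV (\<lambda>_. A \<Otimes>\<^sub>M Y))"
    by (simp add: trajectory_law_def)
  interpret CI: prob_space "CI {}"
    by (rule PF.prob_space_P) auto
  have "emeasure PF.lim (PF.emb UNIV {} (space (CI {}))) = emeasure (CI {}) (space (CI {}))"
    by (rule lim) (auto simp: CI_def)
  also have "PF.emb UNIV {} (space (CI {})) = space PF.lim"
    by (auto simp: CI_def prod_emb_def space_PiM)
  finally show "prob_space (trajectory_law A Y R \<pi>)"
    by (intro prob_spaceI) (simp add: trajectory_law_def CI.emeasure_space_1)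
qed

lemma outcome_law:
  assumes P: "\<And>i. i \<in> {1..M} \<Longrightarrow> P i \<in> A \<rightarrow>\<^sub>M prob_algebra Y" and \<pi>: "is_policy A Y \<pi>"
    and b0: "\<And>i. i \<in> {1..M} \<Longrightarrow> b0 i > 0" "(\<Sum>i\<in>{1..M}. b0 i) = 1"
  shows "prob_space (outcome_law M A Y P b0 \<pi>)"
    and "sets (outcome_law M A Y P b0 \<pi>) = sets (outcome_space M A Y)"
proof -
  let ?K = "\<lambda>i. distr (trajectory_law A Y (P i) \<pi>) (outcome_space M A Y) (Pair i)"
  let ?B = "point_measure {1..M} (\<lambda>i. ennreal (b0 i))"
  have K: "prob_space (?K i)" if "i \<in> {1..M}" for i
  proof -
    have "Pair i \<in> trajectory_law A Y (P i) \<pi> \<rightarrow>\<^sub>M outcome_space M A Y"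
      using that by (simp add: outcome_space_def trajectory_law(2)[OF P \<pi>] cong: measurable_cong_sets)
    then show ?thesis
      by (rule prob_space.prob_space_distr[OF trajectory_law(1)[OF P[OF that] \<pi>]])
  qed
  have B: "prob_space ?B"
  proof
    have "(\<Sum>i\<in>{1..M}. ennreal (b0 i)) = ennreal (\<Sum>i\<in>{1..M}. b0 i)"
      using b0(1) by (intro sum_ennreal) (auto intro: less_imp_le)
    then show "emeasure ?B (space ?B) = 1"
      by (simp add: space_point_measure emeasure_point_measure_finite b0(2)[simplified])
  qed
  then have ne: "space ?B \<noteq> {}"
    by (rule prob_space.not_empty)
  have m: "?K \<in> ?B \<rightarrow>\<^sub>M subprob_algebra (outcome_space M A Y)"
    using K by (auto simp: measurable_def space_point_measure sets_point_measure
        space_subprob_algebra prob_space_imp_subprob_space)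
  show "sets (outcome_law M A Y P b0 \<pi>) = sets (outcome_space M A Y)"
    unfolding outcome_law_def using ne by (intro sets_bind) simp_all
  show "prob_space (outcome_law M A Y P b0 \<pi>)"
    unfolding outcome_law_def
    by (rule prob_space.prob_space_bind[OF B _ m]) (auto simp: space_point_measure K)
qed

lemma filtration_history_filtration:
  "filtration (space (outcome_space M A Y)) (history_filtration M A Y)"
proof
  show "space (history_filtration M A Y t) = space (outcome_space M A Y)" for t
    by (simp add: history_filtration_def)
next
  fix s t :: enat
  assume "s \<le> t"
  then have sub: "{n. enat n < s} \<subseteq> {n. enat n < t}"
    by auto
  let ?\<Omega> = "space (outcome_space M A Y)"
  let ?r = "\<lambda>t \<omega>. restrict (snd \<omega> :: nat \<Rightarrow> _) {n. enat n < t}"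
  have r: "?r t \<in> ?\<Omega> \<rightarrow> space (PiM {n. enat n < t} (\<lambda>_. A \<Otimes>\<^sub>M Y))" for t
    by (auto simp: outcome_space_def space_pair_measure space_PiM PiE_iff extensional_def split: if_splits)
  have "(\<lambda>h. restrict h {n. enat n < s}) \<circ> ?r t
      \<in> history_filtration M A Y t \<rightarrow>\<^sub>M PiM {n. enat n < s} (\<lambda>_. A \<Otimes>\<^sub>M Y)"
    unfolding history_filtration_def
    by (rule measurable_comp[OF measurable_vimage_algebra1[OF r] measurable_restrict_subset[OF sub]])
  also have "(\<lambda>h. restrict h {n. enat n < s}) \<circ> ?r t = ?r s"
    using sub by (auto simp: fun_eq_iff restrict_def)
  finally have *: "?r s \<in> history_filtration M A Y t \<rightarrow>\<^sub>M PiM {n. enat n < s} (\<lambda>_. A \<Otimes>\<^sub>M Y)" .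
  have "space (history_filtration M A Y t) = ?\<Omega>"
    by (simp add: history_filtration_def)
  then show "sets (history_filtration M A Y s) \<subseteq> sets (history_filtration M A Y t)"
    using measurable_sets[OF *] unfolding history_filtration_def[of M A Y s]
    by (auto simp: sets_vimage_algebra2[OF r])
qed

end

theory Submission
  imports Defs
begin

text \<open>
  Knock-out tournament: a champion, initially 1, meets the challengers \<open>2, \<dots>, M\<close> one after the other.
  The match between \<open>c < d\<close> spends \<open>n\<close> rounds on an action that separates \<open>Q\<^sub>c\<close> from \<open>Q\<^sub>d\<close> and counts
  how often the summary falls into \<open>B = {k. Q\<^sub>c k < Q\<^sub>d k}\<close>. Since \<open>Q\<^sub>d B - Q\<^sub>c B\<close> is half the \<open>L\<^sup>1\<close> distance,
  hence at least \<open>\<eta> / 2\<close>, comparing the frequency with the midpoint of \<open>Q\<^sub>c B\<close> and \<open>Q\<^sub>d B\<close> makes the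
  true index lose a given match with probability at most \<open>exp (- n \<eta>\<^sup>2 / 8)\<close> (Hoeffding), and it plays at
  most \<open>M - 1\<close> matches. Because the matches depend on earlier responses, the Chernoff bounds and the
  union bound are combined into one nonnegative supermartingale along the histories, for which only
  one-round integrals have to be estimated.
\<close>

section \<open>Supermartingales along the histories\<close>

text \<open>The expectation of \<open>g t\<close> cannot increase with \<open>t\<close>: the round
  kernels are integrated out one at a time by induction. The trajectory law enters only through its
  projection onto the first \<open>N\<close> rounds.\<close>

lemma nn_integral_trajectory_law_le:
  assumes R: "R \<in> A \<rightarrow>\<^sub>M prob_algebra Y" and \<pi>: "is_policy A Y \<pi>"
    and g[measurable]: "\<And>t. g t \<in> borel_measurable (PiM {0..<t} (\<lambda>_. A \<Otimes>\<^sub>M Y))"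
    and step: "\<And>t h. t < N \<Longrightarrow> h \<in> space (PiM {0..<t} (\<lambda>_. A \<Otimes>\<^sub>M Y)) \<Longrightarrow>
      (\<integral>\<^sup>+z. g (Suc t) (h(t := z)) \<partial>round_kernel A Y R \<pi> t h) \<le> g t h"
  shows "(\<integral>\<^sup>+\<omega>. g N (restrict \<omega> {0..<N}) \<partial>trajectory_law A Y R \<pi>) \<le> g 0 (\<lambda>_. undefined)"
proof -
  interpret IT: Ionescu_Tulcea "round_kernel A Y R \<pi>" "\<lambda>_. A \<Otimes>\<^sub>M Y"
    by (rule Ionescu_Tulcea_round_kernel[OF R \<pi>])
  let ?Q = "\<lambda>t. PiM {0..<t} (\<lambda>_. A \<Otimes>\<^sub>M Y)"
  \<comment> \<open>The only point of the product over \<open>{0..<0}\<close>, that is, the empty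
    history.\<close>
  let ?u = "\<lambda>_::nat. undefined :: 'a \<times> 'b"
  have u: "?u \<in> space (?Q 0)"
    by (simp add: space_PiM)
  have C: "(\<integral>\<^sup>+h. g t h \<partial>IT.C 0 t ?u) \<le> g 0 ?u" if "t \<le> N" for t
    using that
  proof (induction t)
    case 0
    then show ?case
      using nn_integral_return[OF u g] by simp
  next
    case (Suc t)
    have sC: "sets (IT.C 0 t ?u) = sets (?Q t)"
      using IT.sets_C[OF u, of t] by simp
    have "(\<integral>\<^sup>+h. g (Suc t) h \<partial>IT.C 0 (Suc t) ?u)
        = (\<integral>\<^sup>+h. \<integral>\<^sup>+h'. g (Suc t) h' \<partial>IT.eP t h \<partial>IT.C 0 t ?u)"
      using IT.measurable_eP[of t] sC
      by (simp add: nn_integral_bind[where B="?Q (Suc t)"] cong: measurable_cong_sets)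
    also have "\<dots> \<le> (\<integral>\<^sup>+h. g t h \<partial>IT.C 0 t ?u)"
      using Suc.prems sets_eq_imp_space_eq[OF sC]
      by (intro nn_integral_mono) (simp add: IT.nn_integral_eP step)
    finally show ?case
      using Suc by simp
  qed
  have sT: "sets (trajectory_law A Y R \<pi>) = sets (PiM UNIV (\<lambda>_. A \<Otimes>\<^sub>M Y))"
    by (rule trajectory_law[OF R \<pi>])
  have r: "(\<lambda>\<omega>. restrict \<omega> {0..<N}) \<in> trajectory_law A Y R \<pi> \<rightarrow>\<^sub>M ?Q N"
    unfolding measurable_cong_sets[OF sT refl] by (rule measurable_restrict_subset) simp
  \<comment> \<open>The limit measure is determined on cylinders over the first \<open>N\<close>
    coordinates, where it agrees with \<open>N\<close> kernel steps from the empty history.\<close>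
  have eq: "distr (trajectory_law A Y R \<pi>) (?Q N) (\<lambda>\<omega>. restrict \<omega> {0..<N}) = IT.C 0 N ?u"
  proof (rule measure_eqI)
    show "sets (distr (trajectory_law A Y R \<pi>) (?Q N) (\<lambda>\<omega>. restrict \<omega> {0..<N})) = sets (IT.C 0 N ?u)"
      using IT.sets_C[OF u, of N] by simp
  next
    fix X assume "X \<in> sets (distr (trajectory_law A Y R \<pi>) (?Q N) (\<lambda>\<omega>. restrict \<omega> {0..<N}))"
    then have X: "X \<in> sets (?Q N)"
      by simp
    have "emeasure (distr (trajectory_law A Y R \<pi>) (?Q N) (\<lambda>\<omega>. restrict \<omega> {0..<N})) X
        = emeasure (trajectory_law A Y R \<pi>) (prod_emb UNIV (\<lambda>_. A \<Otimes>\<^sub>M Y) {0..<N} X)"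
      using X r by (simp add: emeasure_distr prod_emb_def sets_eq_imp_space_eq[OF sT] space_PiM)
    also have "\<dots> = emeasure (IT.CI {0..<N}) X"
      unfolding trajectory_law_def using X by (intro IT.lim) auto
    also have "\<dots> = emeasure (IT.C 0 N ?u) X"
      using IT.emeasure_CI[OF order_refl X] sets.sets_into_space[OF X]
      by (simp add: prod_emb_id space_PiM)
    finally show "emeasure (distr (trajectory_law A Y R \<pi>) (?Q N) (\<lambda>\<omega>. restrict \<omega> {0..<N})) X
        = emeasure (IT.C 0 N ?u) X" .
  qed
  have "(\<integral>\<^sup>+\<omega>. g N (restrict \<omega> {0..<N}) \<partial>trajectory_law A Y R \<pi>) = (\<integral>\<^sup>+h. g N h \<partial>IT.C 0 N ?u)"
    unfolding eq[symmetric] by (simp add: nn_integral_distr[OF r])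
  with C[of N] show ?thesis
    by simp
qed

section \<open>Deterministic policies driven by a countable memory\<close>

locale memory_policy =
  fixes A :: "'a measure" and Y :: "'y measure"
    and act :: "nat \<Rightarrow> 's::countable \<Rightarrow> 'a" and upd :: "nat \<Rightarrow> 's \<Rightarrow> 'y \<Rightarrow> 's" and s0 :: 's
  assumes act: "act t s \<in> space A"
    and upd: "upd t s \<in> Y \<rightarrow>\<^sub>M count_space UNIV"
begin

primrec memory :: "nat \<Rightarrow> (nat \<Rightarrow> 'a \<times> 'y) \<Rightarrow> 's" where
  "memory 0 h = s0"
| "memory (Suc t) h = upd t (memory t h) (snd (h t))"

definition policy :: "nat \<Rightarrow> (nat \<Rightarrow> 'a \<times> 'y) \<Rightarrow> 'a measure" where
  "policy t h = return A (act t (memory t h))"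

lemma memory_cong: "(\<And>s. s < t \<Longrightarrow> h s = h' s) \<Longrightarrow> memory t h = memory t h'"
  by (induction t) auto

lemma memory_restrict: "{0..<t} \<subseteq> J \<Longrightarrow> memory t (restrict h J) = memory t h"
  by (rule memory_cong) auto

text \<open>As the state type is countable, measurability of the update is needed only for each
  fixed state. \<open>J\<close> is left free because the memory is read off histories, whole
  trajectories and the coordinates visible to the filtration.\<close>

lemma measurable_memory:
  "{0..<t} \<subseteq> J \<Longrightarrow> memory t \<in> PiM J (\<lambda>_. A \<Otimes>\<^sub>M Y) \<rightarrow>\<^sub>M count_space UNIV"
proof (induction t)
  case 0
  then show ?case by simp
next
  case (Suc t)
  then have "t \<in> J" and IH: "memory t \<in> PiM J (\<lambda>_. A \<Otimes>\<^sub>M Y) \<rightarrow>\<^sub>M count_space UNIV"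
    by (auto simp: subset_iff)
  then have "(\<lambda>h. snd (h t)) \<in> PiM J (\<lambda>_. A \<Otimes>\<^sub>M Y) \<rightarrow>\<^sub>M Y"
    by measurable
  then have "(\<lambda>h. upd t s (snd (h t))) \<in> PiM J (\<lambda>_. A \<Otimes>\<^sub>M Y) \<rightarrow>\<^sub>M count_space UNIV" for s
    by (rule measurable_compose[OF _ upd])
  then have "(\<lambda>h. upd t (memory t h) (snd (h t))) \<in> PiM J (\<lambda>_. A \<Otimes>\<^sub>M Y) \<rightarrow>\<^sub>M count_space UNIV"
    using IH by (rule measurable_compose_countable)
  then show ?case
    by simp
qed

lemma is_policy: "is_policy A Y policy"
  unfolding is_policy_def
proof
  fix t
  have "(\<lambda>s. return A (act t s)) \<in> count_space UNIV \<rightarrow>\<^sub>M prob_algebra A"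
    using act by (simp add: space_prob_algebra prob_space_return)
  then have "(\<lambda>h. return A (act t (memory t h))) \<in> PiM {0..<t} (\<lambda>_. A \<Otimes>\<^sub>M Y) \<rightarrow>\<^sub>M prob_algebra A"
    using measurable_memory by (rule measurable_compose[rotated]) simp
  then show "policy t \<in> PiM {0..<t} (\<lambda>_. A \<Otimes>\<^sub>M Y) \<rightarrow>\<^sub>M prob_algebra A"
    by (simp add: policy_def[abs_def])
qed

lemma supported_on:
  assumes "C \<in> sets A" and "\<And>t s. act t s \<in> C"
  shows "supported_on A Y policy C"
  using assms by (simp add: supported_on_def policy_def measure_return)

lemma round_kernel_policy:
  assumes R: "R \<in> A \<rightarrow>\<^sub>M prob_algebra Y"
  shows "round_kernel A Y R policy t h
    = distr (R (act t (memory t h))) (A \<Otimes>\<^sub>M Y) (Pair (act t (memory t h)))"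
proof -
  have "(\<lambda>a. distr (R a) (A \<Otimes>\<^sub>M Y) (Pair a)) \<in> A \<rightarrow>\<^sub>M prob_algebra (A \<Otimes>\<^sub>M Y)"
    by (rule measurable_distr_prob_space2[OF R]) simp
  then show ?thesis
    unfolding round_kernel_def policy_def
    by (intro bind_return[where N="A \<Otimes>\<^sub>M Y"] act measurable_prob_algebraD)
qed

lemma memory_invariant:
  assumes "I 0 s0" and "\<And>t s y. t < N \<Longrightarrow> I t s \<Longrightarrow> I (Suc t) (upd t s y)"
  shows "t \<le> N \<Longrightarrow> I t (memory t h)"
  by (induction t) (auto simp: assms)

text \<open>Action and update depend on the past only through the memory, so the supermartingale
  condition becomes an integral over one response. The invariant \<open>I\<close> confines it to a
  set containing all reachable states.\<close>

lemma nn_integral_memory_le: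
  fixes g :: "nat \<Rightarrow> 's \<Rightarrow> ennreal"
  assumes R: "R \<in> A \<rightarrow>\<^sub>M prob_algebra Y"
    and inv: "I 0 s0" "\<And>t s y. t < N \<Longrightarrow> I t s \<Longrightarrow> I (Suc t) (upd t s y)"
    and step: "\<And>t s. t < N \<Longrightarrow> I t s \<Longrightarrow> (\<integral>\<^sup>+y. g (Suc t) (upd t s y) \<partial>R (act t s)) \<le> g t s"
  shows "(\<integral>\<^sup>+\<omega>. g N (memory N \<omega>) \<partial>trajectory_law A Y R policy) \<le> g 0 s0"
proof -
  have "(\<integral>\<^sup>+\<omega>. g N (memory N (restrict \<omega> {0..<N})) \<partial>trajectory_law A Y R policy)
      \<le> g 0 (memory 0 (\<lambda>_. undefined))"
  proof (rule nn_integral_trajectory_law_le[OF R is_policy])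
    show "(\<lambda>h. g t (memory t h)) \<in> borel_measurable (PiM {0..<t} (\<lambda>_. A \<Otimes>\<^sub>M Y))" for t
      by (rule measurable_compose[OF measurable_memory]) simp_all
  next
    fix t h assume t: "t < N" and h: "h \<in> space (PiM {0..<t} (\<lambda>_. A \<Otimes>\<^sub>M Y))"
    let ?s = "memory t h"
    let ?a = "act t ?s"
    have sR: "sets (R ?a) = sets Y"
      using measurable_space[OF R act] by (simp add: space_prob_algebra)
    have m: "memory t (h(t := z)) = ?s" for z
      by (rule memory_cong) simp
    have "(\<lambda>y. upd t ?s y) \<in> Y \<rightarrow>\<^sub>M count_space UNIV"
      by (rule upd)
    then have "(\<lambda>z. upd t ?s (snd z)) \<in> A \<Otimes>\<^sub>M Y \<rightarrow>\<^sub>M count_space UNIV"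
      by (rule measurable_compose[OF measurable_snd])
    then have f: "(\<lambda>z. g (Suc t) (upd t ?s (snd z))) \<in> borel_measurable (A \<Otimes>\<^sub>M Y)"
      by (rule measurable_compose) simp
    have p: "Pair ?a \<in> R ?a \<rightarrow>\<^sub>M A \<Otimes>\<^sub>M Y"
      using act by (simp add: measurable_cong_sets[OF sR refl])
    have "(\<integral>\<^sup>+z. g (Suc t) (memory (Suc t) (h(t := z))) \<partial>round_kernel A Y R policy t h)
        = (\<integral>\<^sup>+y. g (Suc t) (upd t ?s y) \<partial>R ?a)"
      by (simp add: m round_kernel_policy[OF R] nn_integral_distr[OF p] f)
    also have "\<dots> \<le> g t ?s"
      using t memory_invariant[of I N t h, OF inv] by (intro step) auto
    finally show "(\<integral>\<^sup>+z. g (Suc t) (memory (Suc t) (h(t := z))) \<partial>round_kernel A Y R policy t h)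
        \<le> g t ?s" .
  qed
  then show ?thesis
    by (simp add: memory_restrict)
qed

end

text \<open>The estimate reads only the first \<open>N\<close> coordinates, which are visible at
  every \<open>t\<close> with \<open>enat N \<le> t\<close>, including infinity; for smaller
  \<open>t\<close> the set to be tested is empty.\<close>

lemma (in memory_policy) admissible_fixed_time:
  assumes "C \<in> sets A" and "\<And>t s. act t s \<in> C" and e: "\<And>h. e (memory N h) \<in> {1..M}"
  shows "admissible M A Y P b0 C policy (\<lambda>_. enat N) (\<lambda>\<omega>. e (memory N (snd \<omega>)))"
proof -
  let ?\<Omega> = "space (outcome_space M A Y)" and ?F = "history_filtration M A Y"
  interpret F: filtration ?\<Omega> ?F
    by (rule filtration_history_filtration)
  have st: "stopping_time ?F (\<lambda>_. enat N)"
    by (rule stopping_time_const)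
  have "(\<lambda>\<omega>. e (memory N (snd \<omega>))) -` {a} \<inter> ?\<Omega> \<in> sets (F.pre_sigma (\<lambda>_. enat N))" for a
  proof (rule F.sets_pre_sigmaI[OF st])
    fix t
    show "{\<omega> \<in> (\<lambda>\<omega>. e (memory N (snd \<omega>))) -` {a} \<inter> ?\<Omega>. enat N \<le> t} \<in> sets (?F t)"
    proof (cases "enat N \<le> t")
      case True
      let ?J = "{s. enat s < t}"
      have J: "{0..<N} \<subseteq> ?J"
        using True by (auto intro: less_le_trans[of _ "enat N"])
      have r: "(\<lambda>\<omega>. restrict (snd \<omega>) ?J) \<in> ?\<Omega> \<rightarrow> space (PiM ?J (\<lambda>_. A \<Otimes>\<^sub>M Y))"
        by (auto simp: outcome_space_def space_pair_measure space_PiM PiE_iff split: if_splits)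
      have "(\<lambda>\<omega>. memory N (restrict (snd \<omega>) ?J)) \<in> ?F t \<rightarrow>\<^sub>M count_space UNIV"
        unfolding history_filtration_def
        by (rule measurable_compose[OF measurable_vimage_algebra1[OF r] measurable_memory[OF J]])
      then have "(\<lambda>\<omega>. e (memory N (snd \<omega>))) \<in> ?F t \<rightarrow>\<^sub>M count_space UNIV"
        unfolding memory_restrict[OF J] by (rule measurable_compose) simp
      from measurable_sets[OF this, of "{a}"] show ?thesis
        using True by (simp add: F.space_F vimage_def Int_def)
    qed simp
  qed
  then have "(\<lambda>\<omega>. e (memory N (snd \<omega>))) \<in> F.pre_sigma (\<lambda>_. enat N) \<rightarrow>\<^sub>M count_space {1..M}"
    using e by (simp add: measurable_count_space_eq2 F.space_pre_sigma)
  then show ?thesis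
    using st is_policy supported_on[OF assms(1,2)] by (simp add: admissible_def)
qed

section \<open>Total probability over the unknown index\<close>

lemma emeasure_outcome_law:
  assumes P: "\<And>i. i \<in> {1..M} \<Longrightarrow> P i \<in> A \<rightarrow>\<^sub>M prob_algebra Y" and \<pi>: "is_policy A Y \<pi>"
    and M: "1 \<le> M" and X: "X \<in> sets (outcome_space M A Y)"
  shows "emeasure (outcome_law M A Y P b0 \<pi>) X = (\<Sum>i\<in>{1..M}. ennreal (b0 i) *
    emeasure (trajectory_law A Y (P i) \<pi>) (Pair i -` X \<inter> space (trajectory_law A Y (P i) \<pi>)))"
proof -
  let ?B = "point_measure {1..M} (\<lambda>i. ennreal (b0 i))"
  let ?K = "\<lambda>i. distr (trajectory_law A Y (P i) \<pi>) (outcome_space M A Y) (Pair i)"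
  have p: "Pair i \<in> trajectory_law A Y (P i) \<pi> \<rightarrow>\<^sub>M outcome_space M A Y" if "i \<in> {1..M}" for i
    using that by (simp add: outcome_space_def trajectory_law(2)[OF P \<pi>] cong: measurable_cong_sets)
  have "prob_space (?K i)" if "i \<in> {1..M}" for i
    by (rule prob_space.prob_space_distr[OF trajectory_law(1)[OF P[OF that] \<pi>] p[OF that]])
  then have m: "?K \<in> ?B \<rightarrow>\<^sub>M subprob_algebra (outcome_space M A Y)"
    by (auto simp: measurable_def space_point_measure sets_point_measure
        space_subprob_algebra prob_space_imp_subprob_space)
  have "emeasure (outcome_law M A Y P b0 \<pi>) X = (\<integral>\<^sup>+i. emeasure (?K i) X \<partial>?B)"
    unfolding outcome_law_def using M by (intro emeasure_bind[OF _ m X]) (simp add: space_point_measure)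
  also have "\<dots> = (\<Sum>i\<in>{1..M}. ennreal (b0 i) * emeasure (?K i) X)"
    by (simp add: nn_integral_point_measure_finite)
  finally show ?thesis
    using p X by (simp add: emeasure_distr)
qed

section \<open>The tournament and its potential\<close>

text \<open>\<open>thr c d\<close> is a threshold per round. Nothing ties \<open>hit\<close> and
  \<open>thr\<close> to the responses here; that a match is informative enters later, as a bound on
  one-round exponential moments.\<close>

locale tournament =
  fixes n :: nat and thr :: "nat \<Rightarrow> nat \<Rightarrow> real" and hit :: "nat \<Rightarrow> nat \<Rightarrow> 'y \<Rightarrow> bool"
  assumes n: "0 < n"
begin

text \<open>
  The state is the champion together with the hits of the current match. The hits are not cleared
  when a match ends; \<open>hits\<close> discards the stale value in the first round of the next match.
\<close>

definition challenger :: "nat \<Rightarrow> nat" where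
  "challenger t = t div n + 2"

definition hits :: "nat \<Rightarrow> nat \<Rightarrow> nat" where
  "hits t k = (if t mod n = 0 then 0 else k)"

fun play :: "nat \<Rightarrow> nat \<times> nat \<Rightarrow> 'y \<Rightarrow> nat \<times> nat" where
  "play t (c, k) y =
     (let d = challenger t; k' = hits t k + of_bool (hit c d y)
      in (if Suc t mod n = 0 \<and> real n * thr c d \<le> real k' then d else c, k'))"

lemma measurable_play:
  assumes h: "Measurable.pred N (hit (fst s) (challenger t))"
  shows "play t s \<in> N \<rightarrow>\<^sub>M count_space UNIV"
proof -
  define f where "f b = (let k' = hits t (snd s) + of_bool b
      in (if Suc t mod n = 0 \<and> real n * thr (fst s) (challenger t) \<le> real k' then challenger t else fst s, k'))" for b
  have "(\<lambda>y. f (hit (fst s) (challenger t) y)) \<in> N \<rightarrow>\<^sub>M count_space UNIV"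
    by (rule measurable_compose[OF h]) simp
  also have "(\<lambda>y. f (hit (fst s) (challenger t) y)) = play t s"
    by (cases s) (simp add: fun_eq_iff f_def Let_def)
  finally show ?thesis .
qed

lemma play_champion:
  assumes "fst s \<in> {1..<challenger t}"
  shows "fst (play t s y) \<in> {1..<challenger (Suc t)}"
  using assms by (cases s) (auto simp: Let_def challenger_def div_Suc)

text \<open>For \<open>1 \<le> i < challenger t\<close>, index \<open>i\<close> was the initial
  champion or has already played as challenger. Challengers only increase, so if it is not champion
  now, it never will be again.\<close>

definition lost :: "nat \<Rightarrow> nat \<Rightarrow> nat \<Rightarrow> bool" where
  "lost i t c \<longleftrightarrow> i < challenger t \<and> c \<noteq> i"

text \<open>The sign of the deviation that harms \<open>i\<close>: too many hits if it is champion,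
  too few if it is challenger.\<close>

definition side :: "nat \<Rightarrow> nat \<Rightarrow> real" where
  "side i c = (if c = i then 1 else - 1)"

text \<open>
  A bound on the conditional probability, given the state before round \<open>t\<close>, that \<open>i\<close> does not win the
  tournament: \<open>q ^ n\<close> for each match still to come, plus the Chernoff bound for the running match if
  \<open>i\<close> takes part in it. After the last round the challenger is \<open>M + 1\<close>, and the negative first summand
  cancels the second one.
\<close>

fun potential :: "nat \<Rightarrow> real \<Rightarrow> nat \<Rightarrow> nat \<Rightarrow> nat \<times> nat \<Rightarrow> real" where
  "potential M \<eta> i t (c, k) =
     (let q = exp (- (\<eta>\<^sup>2 / 8)); d = challenger t; s = t mod n in
      if lost i t c then 1
      else (real M - real d) * q ^ n +
        (if i \<in> {c, d}
         then exp (side i c * \<eta> * (real (hits t k) - real s * thr c d)) * q ^ (n - s)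
         else q ^ n))"

lemma potential_start:
  assumes "1 \<le> M" and "1 \<le> i"
  shows "potential M \<eta> i 0 (1, k) = real (M - 1) * exp (- (\<eta>\<^sup>2 / 8)) ^ n"
  using assms n by (auto simp: Let_def lost_def challenger_def hits_def algebra_simps of_nat_diff)

lemma potential_end:
  assumes "1 \<le> M" and "i \<le> M" and "c \<noteq> i"
  shows "potential M \<eta> i ((M - 1) * n) (c, k) = 1"
  using assms n by (auto simp: lost_def challenger_def)

text \<open>The next champion is \<open>c\<close> or \<open>challenger t\<close>, both different
  from \<open>i\<close>, so a loss is permanent.\<close>

lemma potential_play_lost:
  assumes "lost i t c"
  shows "potential M \<eta> i (Suc t) (play t (c, k) y) = 1"
proof -
  have "challenger t \<le> challenger (Suc t)"
    by (simp add: challenger_def div_Suc)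
  then show ?thesis
    using assms by (auto simp: Let_def lost_def)
qed

text \<open>An index waiting for its turn cannot lose. Within a match nothing changes, and a
  finished match removes one term \<open>q ^ n\<close>. If \<open>i\<close> comes next, its
  exponential factor is \<open>exp 0\<close>, which again leaves \<open>q ^ n\<close>.\<close>

lemma potential_play_waiting:
  assumes "challenger t < i" and c: "c < challenger t"
  shows "potential M \<eta> i (Suc t) (play t (c, k) y) \<le> potential M \<eta> i t (c, k)"
proof -
  have "challenger (Suc t) = challenger t \<or> Suc t mod n = 0 \<and> challenger (Suc t) = Suc (challenger t)"
    by (auto simp: challenger_def div_Suc)
  moreover have "0 < exp (- (\<eta>\<^sup>2 / 8)) ^ n"
    by simp
  ultimately show ?thesis
    using assms by (auto simp: Let_def lost_def hits_def algebra_simps)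
qed

text \<open>\<open>W\<close> gathers the exponential of the deviation so far and the factors
  \<open>q\<close> of the rounds after this one. One round thus trades a factor \<open>q\<close> for
  the exponential of its own deviation, and it remains to bound the mean of the latter by
  \<open>q\<close>.\<close>

lemma potential_play_match:
  fixes i c k t M :: nat and \<eta> :: real
  assumes i: "i \<in> {c, challenger t}" and c: "c < challenger t" and d: "challenger t \<le> M" and \<eta>: "0 < \<eta>"
  defines "d \<equiv> challenger t"
  defines "q \<equiv> exp (- (\<eta>\<^sup>2 / 8))"
  defines "W \<equiv> exp (side i c * \<eta> * (real (hits t k) - real (t mod n) * thr c d)) * q ^ (n - Suc (t mod n))"
  shows "potential M \<eta> i t (c, k) = (real M - real d) * q ^ n + W * q"
    and "potential M \<eta> i (Suc t) (play t (c, k) y)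
      \<le> (real M - real d) * q ^ n + W * exp (side i c * \<eta> * (of_bool (hit c d y) - thr c d))"
proof -
  let ?s = "t mod n"
  let ?k' = "hits t k + of_bool (hit c d y)"
  have s: "?s < n"
    using n by simp
  then have "q ^ (n - ?s) = q ^ (n - Suc ?s) * q"
    by (metis Suc_diff_Suc power_Suc2)
  then show "potential M \<eta> i t (c, k) = (real M - real d) * q ^ n + W * q"
    using i c by (auto simp: lost_def d_def[symmetric] W_def q_def[symmetric] Let_def)
  have W: "W * exp (side i c * \<eta> * (of_bool (hit c d y) - thr c d))
      = exp (side i c * \<eta> * (real ?k' - real (Suc ?s) * thr c d)) * q ^ (n - Suc ?s)"
    by (simp add: W_def exp_add[symmetric] algebra_simps)
  have q: "0 < q"
    by (simp add: q_def)
  have rem: "0 \<le> (real M - real d) * q ^ n"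
    using d q by (simp add: d_def)
  show "potential M \<eta> i (Suc t) (play t (c, k) y)
      \<le> (real M - real d) * q ^ n + W * exp (side i c * \<eta> * (of_bool (hit c d y) - thr c d))"
  proof (cases "Suc ?s = n")
    case False
    then have "Suc t mod n = Suc ?s" "challenger (Suc t) = d"
      by (auto simp: mod_Suc div_Suc challenger_def d_def)
    then show ?thesis
      unfolding W using i c
      by (auto simp: lost_def d_def[symmetric] q_def[symmetric] Let_def hits_def)
  next
    case True
    then have m: "Suc t mod n = 0" and d': "challenger (Suc t) = Suc d"
      by (auto simp: mod_Suc div_Suc challenger_def d_def)
    define c' where "c' = (if real n * thr c d \<le> real ?k' then d else c)"
    have play: "play t (c, k) y = (c', ?k')"
      by (simp add: Let_def d_def c'_def m)
    show ?thesis
    proof (cases "c' = i")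
      case True
      \<comment> \<open>After a win the next match starts with \<open>exp 0\<close>; its
        \<open>q ^ n\<close> makes up for the drop from \<open>real M - real d\<close> to
        \<open>real M - real (Suc d)\<close>. For \<open>d = M\<close> that match is
        fictitious.\<close>
      then have "potential M \<eta> i (Suc t) (play t (c, k) y) = (real M - real d) * q ^ n"
        unfolding play using m d' by (simp add: lost_def hits_def Let_def q_def[symmetric] algebra_simps)
      then show ?thesis
        by (simp add: W_def q less_imp_le)
    next
      case False
      \<comment> \<open>A losing champion faces at least \<open>n * thr c d\<close> hits with sign
        1, a losing challenger has fewer with sign -1. As no factor \<open>q\<close> is left, the
        bound is at least 1, the potential of a lost index.\<close>
      have "0 \<le> side i c * (real ?k' - real n * thr c d)"
        using False i c unfolding c'_def side_def by (auto simp: d_def[symmetric] split: if_splits)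
      then have "0 \<le> \<eta> * (side i c * (real ?k' - real n * thr c d))"
        by (rule mult_nonneg_nonneg[OF less_imp_le[OF \<eta>]])
      then have "0 \<le> side i c * \<eta> * (real ?k' - real n * thr c d)"
        by (simp only: mult.assoc mult.left_commute)
      then have "1 \<le> W * exp (side i c * \<eta> * (of_bool (hit c d y) - thr c d))"
        unfolding W \<open>Suc ?s = n\<close> by (simp only: diff_self_eq_0 power_0 mult_1_right one_le_exp_iff)
      moreover have "potential M \<eta> i (Suc t) (play t (c, k) y) = 1"
        unfolding play using False i c d' by (auto simp: lost_def d_def[symmetric])
      ultimately show ?thesis
        using rem by simp
    qed
  qed
qed

text \<open>Averaging over the response matters only while \<open>i\<close> is playing; otherwise
  the potential does not increase for any response.\<close>

lemma nn_integral_potential_play_le: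
  assumes N: "prob_space N" and h[measurable]: "Measurable.pred N (hit c (challenger t))"
    and c: "c < challenger t" and d: "challenger t \<le> M" and \<eta>: "0 < \<eta>"
    and conc: "i \<in> {c, challenger t} \<Longrightarrow>
      (\<integral>\<^sup>+y. ennreal (exp (side i c * \<eta> * (of_bool (hit c (challenger t) y) - thr c (challenger t)))) \<partial>N)
        \<le> ennreal (exp (- (\<eta>\<^sup>2 / 8)))"
  shows "(\<integral>\<^sup>+y. ennreal (potential M \<eta> i (Suc t) (play t (c, k) y)) \<partial>N) \<le> ennreal (potential M \<eta> i t (c, k))"
proof -
  interpret prob_space N by fact
  have const: ?thesis if "\<And>y. potential M \<eta> i (Suc t) (play t (c, k) y) \<le> potential M \<eta> i t (c, k)"
  proof -
    have "(\<integral>\<^sup>+y. ennreal (potential M \<eta> i (Suc t) (play t (c, k) y)) \<partial>N)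
        \<le> (\<integral>\<^sup>+y. ennreal (potential M \<eta> i t (c, k)) \<partial>N)"
      using that by (intro nn_integral_mono ennreal_leI)
    then show ?thesis
      by (simp add: emeasure_space_1)
  qed
  \<comment> \<open>An index below \<open>challenger t\<close> is either lost or the champion
    \<open>c\<close>.\<close>
  consider "lost i t c" | "challenger t < i" | "i \<in> {c, challenger t}"
    using linorder_less_linear[of i "challenger t"] by (auto simp: lost_def)
  then show ?thesis
  proof cases
    case 1
    show ?thesis
      by (rule const) (use 1 in \<open>simp add: potential_play_lost[OF 1] del: play.simps\<close>)
  next
    case 2
    show ?thesis
      by (rule const) (rule potential_play_waiting[OF 2 c])
  next
    case 3
    let ?d = "challenger t"
    let ?q = "exp (- (\<eta>\<^sup>2 / 8))"
    let ?E = "\<lambda>y. exp (side i c * \<eta> * (of_bool (hit c ?d y) - thr c ?d))"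
    define R where "R = (real M - real ?d) * ?q ^ n"
    define W where "W = exp (side i c * \<eta> * (real (hits t k) - real (t mod n) * thr c ?d)) * ?q ^ (n - Suc (t mod n))"
    have R: "0 \<le> R" and W: "0 \<le> W"
      using d by (simp_all add: R_def W_def)
    note match = potential_play_match[OF 3 c d \<eta>, of k, folded R_def W_def]
    have "(\<integral>\<^sup>+y. ennreal (potential M \<eta> i (Suc t) (play t (c, k) y)) \<partial>N)
        \<le> (\<integral>\<^sup>+y. ennreal R + ennreal W * ennreal (?E y) \<partial>N)"
      using match(2) R W
      by (intro nn_integral_mono) (simp add: ennreal_leI ennreal_mult[symmetric] ennreal_plus[symmetric] del: ennreal_plus play.simps potential.simps)
    also have "\<dots> = ennreal R + ennreal W * (\<integral>\<^sup>+y. ennreal (?E y) \<partial>N)"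
      by (simp add: nn_integral_add nn_integral_cmult emeasure_space_1)
    also have "\<dots> \<le> ennreal R + ennreal W * ennreal ?q"
      using conc[OF 3] by (intro add_left_mono mult_left_mono) auto
    also have "\<dots> = ennreal (potential M \<eta> i t (c, k))"
      unfolding match(1) using R W by (simp add: ennreal_mult[symmetric] ennreal_plus[symmetric] del: ennreal_plus)
    finally show ?thesis .
  qed
qed

end

section \<open>Tests from separating summaries\<close>

text \<open>Hoeffding's lemma on \<open>[0, 1]\<close> costs
  \<open>exp (\<eta>\<^sup>2 / 8)\<close>, the gap gains \<open>exp (- \<eta>\<^sup>2 / 4)\<close>.
  For a gap of exactly \<open>\<eta> / 4\<close> the parameter \<open>\<eta>\<close> is the optimal
  one.\<close>

lemma exp_moment_of_bool_le:
  assumes "prob_space N" and h[measurable]: "Measurable.pred N h" and "0 < \<eta>"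
    and gap: "measure N {y \<in> space N. h y} + \<eta> / 4 \<le> m"
  shows "(\<integral>\<^sup>+y. ennreal (exp (\<eta> * (of_bool (h y) - m))) \<partial>N) \<le> ennreal (exp (- (\<eta>\<^sup>2 / 8)))"
proof -
  let ?X = "\<lambda>y. of_bool (h y) :: real"
  interpret prob_space N by fact
  interpret X: interval_bounded_random_variable N ?X 0 1
    by unfold_locales auto
  define p where "p = measure N {y \<in> space N. h y}"
  have E: "expectation ?X = p"
  proof -
    have "expectation ?X = expectation (indicator {y \<in> space N. h y})"
      by (intro Bochner_Integration.integral_cong) (auto simp: indicator_def)
    then show ?thesis
      by (simp add: p_def)
  qed
  have "(\<integral>\<^sup>+y. ennreal (exp (\<eta> * (?X y - m))) \<partial>N)
      = (\<integral>\<^sup>+y. ennreal (exp (\<eta> * (p - m))) * ennreal (exp (\<eta> * (?X y - p))) \<partial>N)"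
    by (intro nn_integral_cong) (simp add: ennreal_mult[symmetric] exp_add[symmetric] algebra_simps)
  also have "\<dots> = ennreal (exp (\<eta> * (p - m))) * (\<integral>\<^sup>+y. ennreal (exp (\<eta> * (?X y - p))) \<partial>N)"
    by (intro nn_integral_cmult) measurable
  also have "\<dots> \<le> ennreal (exp (\<eta> * (p - m))) * ennreal (exp (\<eta>\<^sup>2 / 8))"
    using X.Hoeffdings_lemma_nn_integral[OF \<open>0 < \<eta>\<close>] by (intro mult_left_mono) (simp_all add: E)
  also have "\<dots> = ennreal (exp (\<eta> * (p - m) + \<eta>\<^sup>2 / 8))"
    by (simp add: ennreal_mult[symmetric] exp_add)
  also have "\<dots> \<le> ennreal (exp (- (\<eta>\<^sup>2 / 8)))"
  proof -
    have "\<eta> * (p - m) \<le> \<eta> * (- \<eta> / 4)"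
      using gap \<open>0 < \<eta>\<close> by (intro mult_left_mono) (auto simp: p_def)
    then show ?thesis
      by (intro ennreal_leI) (simp add: power2_eq_square)
  qed
  finally show ?thesis .
qed

text \<open>Both masses are 1, so the differences sum to 0: their positive part, collected on
  \<open>B\<close>, balances the negative part, and each is half of the distance.\<close>

lemma l1_dist_eq_measure_diff:
  assumes Q: "prob_space Q" "sets Q = Pow {1..K}" and Q': "prob_space Q'" "sets Q' = Pow {1..K}"
  defines "B \<equiv> {k \<in> {1..K}. measure Q {k} < measure Q' {k}}"
  shows "l1_dist K Q Q' = 2 * (measure Q' B - measure Q B)"
proof -
  interpret Q: prob_space Q by fact
  interpret Q': prob_space Q' by fact
  let ?f = "\<lambda>k. measure Q' {k} - measure Q {k}"
  have B: "B \<subseteq> {1..K}" "finite B"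
    by (auto simp: B_def)
  have sum: "measure Q X = (\<Sum>k\<in>X. measure Q {k})" "measure Q' X = (\<Sum>k\<in>X. measure Q' {k})"
    if "X \<subseteq> {1..K}" for X
    using that finite_subset[OF that] Q(2) Q'(2)
    by (auto intro!: Q.finite_measure_eq_sum_singleton Q'.finite_measure_eq_sum_singleton)
  have "space Q = {1..K}" "space Q' = {1..K}"
    using sets_eq_imp_space_eq[of Q "count_space {1..K}"] sets_eq_imp_space_eq[of Q' "count_space {1..K}"] Q(2) Q'(2)
    by simp_all
  then have total: "(\<Sum>k\<in>{1..K}. ?f k) = 0"
    using sum[OF order_refl] Q.prob_space Q'.prob_space by (simp add: sum_subtractf)
  have "l1_dist K Q Q' = (\<Sum>k\<in>{1..K} - B. \<bar>measure Q {k} - measure Q' {k}\<bar>)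
      + (\<Sum>k\<in>B. \<bar>measure Q {k} - measure Q' {k}\<bar>)"
    unfolding l1_dist_def using B by (intro sum.subset_diff) auto
  also have "(\<Sum>k\<in>{1..K} - B. \<bar>measure Q {k} - measure Q' {k}\<bar>) = - (\<Sum>k\<in>{1..K} - B. ?f k)"
    unfolding sum_negf[symmetric] by (intro sum.cong) (auto simp: B_def)
  also have "(\<Sum>k\<in>B. \<bar>measure Q {k} - measure Q' {k}\<bar>) = (\<Sum>k\<in>B. ?f k)"
    by (intro sum.cong) (auto simp: B_def)
  finally have "l1_dist K Q Q' = - (\<Sum>k\<in>{1..K} - B. ?f k) + (\<Sum>k\<in>B. ?f k)" .
  moreover have "(\<Sum>k\<in>{1..K}. ?f k) = (\<Sum>k\<in>{1..K} - B. ?f k) + (\<Sum>k\<in>B. ?f k)"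
    using B by (intro sum.subset_diff) auto
  moreover have "(\<Sum>k\<in>B. ?f k) = measure Q' B - measure Q B"
    using sum[OF B(1)] by (simp add: sum_subtractf)
  ultimately show ?thesis
    using total by simp
qed

lemma separation_witness:
  assumes fin: "finite (design_actions Act S)" and "0 < \<eta>" and sep: "\<eta> \<le> separation M P K \<phi> Act S"
    and ij: "1 \<le> i" "i < j" "j \<le> M"
  shows "\<exists>a\<in>design_actions Act S. \<eta> \<le> l1_dist K (summary_law K P \<phi> i a) (summary_law K P \<phi> j a)"
proof -
  let ?D = "design_actions Act S"
  let ?l = "\<lambda>i j a. l1_dist K (summary_law K P \<phi> i a) (summary_law K P \<phi> j a)"
  let ?m = "\<lambda>i j. if ?D = {} then 0 else MAX a\<in>?D. ?l i j a"
  have "index_pairs M \<subseteq> {1..M} \<times> {1..M}"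
    by (auto simp: index_pairs_def)
  then have "finite ((\<lambda>(i, j). ?m i j) ` index_pairs M)"
    using finite_subset by blast
  moreover have "?m i j \<in> (\<lambda>(i, j). ?m i j) ` index_pairs M"
    using ij by (force simp: index_pairs_def)
  ultimately have "separation M P K \<phi> Act S \<le> ?m i j"
    unfolding separation_def by (rule Min_le)
  then have "\<eta> \<le> ?m i j"
    using sep by (rule order_trans[rotated])
  \<comment> \<open>Positivity of \<open>\<eta>\<close> excludes the default value 0 for an empty
    action set.\<close>
  then have "?D \<noteq> {}" and "\<eta> \<le> (MAX a\<in>?D. ?l i j a)"
    using \<open>0 < \<eta>\<close> by (auto split: if_splits)
  then show ?thesis
    using fin by (simp add: Max_ge_iff)
qed

text \<open>The two probabilities of \<open>B\<close> differ by at least \<open>\<eta> / 2\<close>,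
  so the midpoint \<open>m\<close> leaves \<open>\<eta> / 4\<close> on either side, as the moment
  bound requires.\<close>

lemma threshold_test_moments:
  fixes \<phi> :: "'y \<Rightarrow> nat"
  assumes N: "prob_space N" and N': "prob_space N'" and s: "sets N = sets N'"
    and \<phi>: "\<phi> \<in> N \<rightarrow>\<^sub>M count_space {1..K}" and \<eta>: "0 < \<eta>"
  defines "Q \<equiv> distr N (count_space {1..K}) \<phi>" and "Q' \<equiv> distr N' (count_space {1..K}) \<phi>"
  defines "B \<equiv> {k \<in> {1..K}. measure Q {k} < measure Q' {k}}"
  defines "m \<equiv> (measure Q B + measure Q' B) / 2"
  assumes sep: "\<eta> \<le> l1_dist K Q Q'"
  shows "(\<integral>\<^sup>+y. ennreal (exp (\<eta> * (of_bool (\<phi> y \<in> B) - m))) \<partial>N) \<le> ennreal (exp (- (\<eta>\<^sup>2 / 8)))"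
    and "(\<integral>\<^sup>+y. ennreal (exp (- \<eta> * (of_bool (\<phi> y \<in> B) - m))) \<partial>N') \<le> ennreal (exp (- (\<eta>\<^sup>2 / 8)))"
proof -
  interpret N: prob_space N by fact
  interpret N': prob_space N' by fact
  have \<phi>': "\<phi> \<in> N' \<rightarrow>\<^sub>M count_space {1..K}"
    using \<phi> by (simp add: measurable_cong_sets[OF s refl])
  have "l1_dist K Q Q' = 2 * (measure Q' B - measure Q B)"
    unfolding B_def using N.prob_space_distr[OF \<phi>] N'.prob_space_distr[OF \<phi>']
    by (intro l1_dist_eq_measure_diff) (simp_all add: Q_def Q'_def)
  then have gap: "measure Q B + \<eta> / 4 \<le> m" "m + \<eta> / 4 \<le> measure Q' B"
    using sep unfolding m_def by (simp_all add: field_simps)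
  have test: "Measurable.pred N (\<lambda>y. \<phi> y \<in> B)" "Measurable.pred N' (\<lambda>y. \<phi> y \<in> B)"
    using \<phi> \<phi>' by (auto intro: measurable_compose)
  have B: "B \<in> sets (count_space {1..K})"
    by (auto simp: B_def)
  have Q: "measure Q B = measure N {y \<in> space N. \<phi> y \<in> B}"
    unfolding Q_def measure_distr[OF \<phi> B] by (rule arg_cong[where f="measure N"]) auto
  have Q': "measure Q' B = measure N' {y \<in> space N'. \<phi> y \<in> B}"
    unfolding Q'_def measure_distr[OF \<phi>' B] by (rule arg_cong[where f="measure N'"]) auto
  show "(\<integral>\<^sup>+y. ennreal (exp (\<eta> * (of_bool (\<phi> y \<in> B) - m))) \<partial>N) \<le> ennreal (exp (- (\<eta>\<^sup>2 / 8)))"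
    using gap(1) unfolding Q by (rule exp_moment_of_bool_le[OF N test(1) \<eta>])
  \<comment> \<open>The second bound is the first one for the complementary test: negating the
    predicate and replacing \<open>m\<close> by \<open>1 - m\<close> flips the sign of the
    exponent.\<close>
  have "measure N' {y \<in> space N'. \<not> \<phi> y \<in> B} = 1 - measure Q' B"
    unfolding Q' using test(2) by (intro N'.prob_neg) simp
  then have "measure N' {y \<in> space N'. \<not> \<phi> y \<in> B} + \<eta> / 4 \<le> 1 - m"
    using gap(2) by simp
  then have "(\<integral>\<^sup>+y. ennreal (exp (\<eta> * (of_bool (\<not> \<phi> y \<in> B) - (1 - m)))) \<partial>N') \<le> ennreal (exp (- (\<eta>\<^sup>2 / 8)))"
    using test(2) by (intro exp_moment_of_bool_le[OF N' _ \<eta>]) simp_all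
  moreover have "\<eta> * (of_bool (\<not> \<phi> y \<in> B) - (1 - m)) = - \<eta> * (of_bool (\<phi> y \<in> B) - m)" for y
    by (simp add: algebra_simps)
  ultimately show "(\<integral>\<^sup>+y. ennreal (exp (- \<eta> * (of_bool (\<phi> y \<in> B) - m))) \<partial>N') \<le> ennreal (exp (- (\<eta>\<^sup>2 / 8)))"
    by simp
qed

section \<open>Number of rounds per match and assembly of the bound\<close>

lemma union_bound_sample_size:
  fixes M :: nat and \<eta> \<delta> :: real
  assumes "2 \<le> M" and "0 < \<eta>" and "0 < \<delta>" and "\<delta> < 1"
  defines "n \<equiv> nat \<lceil>8 / \<eta>\<^sup>2 * ln (real (M - 1) / \<delta>)\<rceil>"
  shows "0 < n" and "real n = real_of_int \<lceil>8 / \<eta>\<^sup>2 * ln (real (M - 1) / \<delta>)\<rceil>"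
    and "real (M - 1) * exp (- (\<eta>\<^sup>2 / 8)) ^ n \<le> \<delta>"
proof -
  let ?m = "real (M - 1)"
  let ?L = "8 / \<eta>\<^sup>2 * ln (?m / \<delta>)"
  have m: "1 \<le> ?m"
    using \<open>2 \<le> M\<close> by simp
  \<comment> \<open>Strictness, from \<open>\<delta> < 1\<close>, gives matches of positive length
    and makes \<open>nat\<close> harmless.\<close>
  have gt: "1 < ?m / \<delta>"
    using m \<open>0 < \<delta>\<close> \<open>\<delta> < 1\<close> by (simp add: field_simps)
  then have L: "0 < ?L"
    using \<open>0 < \<eta>\<close> by (intro mult_pos_pos ln_gt_zero[OF gt]) simp
  then show "0 < n" and n: "real n = real_of_int \<lceil>?L\<rceil>"
    by (simp_all add: n_def)
  have "ln (?m / \<delta>) = \<eta>\<^sup>2 / 8 * ?L"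
    using \<open>0 < \<eta>\<close> by simp
  also have "\<dots> \<le> \<eta>\<^sup>2 / 8 * real n"
    unfolding n by (intro mult_left_mono) auto
  finally have "exp (- (\<eta>\<^sup>2 / 8)) ^ n \<le> exp (- ln (?m / \<delta>))"
    by (simp add: exp_of_nat_mult[symmetric] mult.commute)
  also have "\<dots> = \<delta> / ?m"
    using m \<open>0 < \<delta>\<close> by (simp add: exp_minus)
  finally show "?m * exp (- (\<eta>\<^sup>2 / 8)) ^ n \<le> \<delta>"
    using m by (simp add: field_simps)
qed

lemma inner_value_le:
  assumes "admissible M A Y P b0 C \<pi> \<tau> I"
    and "measure (outcome_law M A Y P b0 \<pi>) {\<omega> \<in> space (outcome_space M A Y). I \<omega> \<noteq> fst \<omega>} \<le> \<delta>"
    and "(\<integral>\<^sup>+\<omega>. ennreal_of_enat (\<tau> \<omega>) \<partial>outcome_law M A Y P b0 \<pi>) \<le> x"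
  shows "inner_value M A Y P b0 C \<delta> \<le> x"
  unfolding inner_value_def using assms by (intro Inf_lower2[OF _ assms(3)]) blast

theorem theorem3p3:
  fixes M K :: nat
    and A :: "'a measure" and Y :: "'y measure"
    and P :: "nat \<Rightarrow> 'a \<Rightarrow> 'y measure"
    and U :: "'u set" and \<kappa> :: "'u \<Rightarrow> real" and Act :: "'u \<Rightarrow> 'a set"
    and \<phi> :: "'a \<Rightarrow> 'y \<Rightarrow> nat"
    and S :: "'u set" and \<eta> \<delta> :: real and b0 :: "nat \<Rightarrow> real"
  assumes "M \<ge> 2"
    and "\<And>i. i \<in> {1..M} \<Longrightarrow> P i \<in> A \<rightarrow>\<^sub>M prob_algebra Y"
    and "jointly_measurable_densities M A Y P"
    and "finite U" and "U \<noteq> {}"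
    and "\<And>u. u \<in> U \<Longrightarrow> \<kappa> u > 0"
    and "\<And>u. u \<in> U \<Longrightarrow> finite (Act u) \<and> Act u \<noteq> {} \<and> Act u \<in> sets A"
    and "K \<ge> 1"
    and "\<And>a. a \<in> space A \<Longrightarrow> \<phi> a \<in> Y \<rightarrow>\<^sub>M count_space {1..K}"
    and "\<eta> > 0"
    and "S \<subseteq> U" and "separation M P K \<phi> Act S \<ge> \<eta>"
    and "\<And>i. i \<in> {1..M} \<Longrightarrow> b0 i > 0" and "(\<Sum>i\<in>{1..M}. b0 i) = 1"
    and "0 < \<delta>" and "\<delta> < 1"
  shows "inner_value M A Y P b0 (design_actions Act S) \<delta>
           \<le> ennreal (real (M - 1) * real_of_int \<lceil>8 / \<eta>\<^sup>2 * ln (real (M - 1) / \<delta>)\<rceil>)"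
proof -
  note P = assms(2) and \<phi> = assms(9) and b0 = assms(13,14)
  define n where "n = nat \<lceil>8 / \<eta>\<^sup>2 * ln (real (M - 1) / \<delta>)\<rceil>"
  note n = union_bound_sample_size[OF \<open>M \<ge> 2\<close> \<open>\<eta> > 0\<close> \<open>0 < \<delta>\<close> \<open>\<delta> < 1\<close>, folded n_def]
  define N where "N = (M - 1) * n"
  let ?D = "design_actions Act S"
  let ?q = "exp (- (\<eta>\<^sup>2 / 8))"
  have finS: "finite S"
    using \<open>finite U\<close> \<open>S \<subseteq> U\<close> by (rule rev_finite_subset)
  then have finD: "finite ?D" and D: "?D \<in> sets A"
    using assms(7) \<open>S \<subseteq> U\<close> by (auto simp: design_actions_def)
  note witness = separation_witness[OF finD \<open>\<eta> > 0\<close> assms(12)]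
  \<comment> \<open>The policy must name an action for every pair, even one out of range; the pair
    \<open>(1, 2)\<close> shows that \<open>?D\<close> has an element to fall back on.\<close>
  have "?D \<noteq> {}"
    using witness[of 1 2] \<open>M \<ge> 2\<close> by auto
  then have "\<forall>p. \<exists>a\<in>?D. 1 \<le> fst p \<and> fst p < snd p \<and> snd p \<le> M \<longrightarrow>
      \<eta> \<le> l1_dist K (summary_law K P \<phi> (fst p) a) (summary_law K P \<phi> (snd p) a)"
    using witness by (metis ex_in_conv)
  then obtain sel' where sel': "sel' p \<in> ?D" "1 \<le> fst p \<and> fst p < snd p \<and> snd p \<le> M \<longrightarrow>
      \<eta> \<le> l1_dist K (summary_law K P \<phi> (fst p) (sel' p)) (summary_law K P \<phi> (snd p) (sel' p))" for p
    by metis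
  define sel where "sel c d = sel' (c, d)" for c d
  have sel: "sel c d \<in> ?D" "sel c d \<in> space A" for c d
    using sel'(1) sets.sets_into_space[OF D] by (auto simp: sel_def)
  have sel_l1: "\<eta> \<le> l1_dist K (summary_law K P \<phi> c (sel c d)) (summary_law K P \<phi> d (sel c d))"
    if "1 \<le> c" "c < d" "d \<le> M" for c d
    using sel'(2)[of "(c, d)"] that by (simp add: sel_def)
  define B where "B c d = {k \<in> {1..K}. measure (summary_law K P \<phi> c (sel c d)) {k}
      < measure (summary_law K P \<phi> d (sel c d)) {k}}" for c d
  define hit where "hit c d y \<longleftrightarrow> \<phi> (sel c d) y \<in> B c d" for c d y
  define thr where "thr c d = (measure (summary_law K P \<phi> c (sel c d)) (B c d)
      + measure (summary_law K P \<phi> d (sel c d)) (B c d)) / 2" for c d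
  have hit: "Measurable.pred Y (hit c d)" for c d
    unfolding hit_def[abs_def] using \<phi>[OF sel(2)] by (rule measurable_compose) simp
  interpret T: tournament n thr hit
    using n(1) by unfold_locales
  interpret W: memory_policy A Y "\<lambda>t s. sel (fst s) (T.challenger t)" T.play "(1, 0)"
    using sel hit by unfold_locales (auto intro: T.measurable_play)
  let ?I = "\<lambda>\<omega>. fst (W.memory N (snd \<omega>))"
  have P_space: "prob_space (P i a)" "sets (P i a) = sets Y" if "i \<in> {1..M}" "a \<in> space A" for i a
    using measurable_space[OF P[OF that(1)] that(2)] by (simp_all add: space_prob_algebra)

  \<comment> \<open>This invariant keeps the final estimate in \<open>{1..M}\<close> and makes every
    running match a pair \<open>c < d\<close>, to which separation applies.\<close>
  let ?valid = "\<lambda>t s. fst s \<in> {1..<T.challenger t}"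
  have valid0: "?valid 0 (1, 0)"
    by (simp add: T.challenger_def)
  have champion: "?valid t (W.memory t h)" for t h
    by (rule W.memory_invariant[where I="?valid" and N=t, OF valid0]) (erule T.play_champion, simp)
  have "T.challenger N = Suc M"
    using \<open>M \<ge> 2\<close> n(1) by (simp add: T.challenger_def N_def)
  then have I: "fst (W.memory N h) \<in> {1..M}" for h
    using champion[of N h] by auto
  have adm: "admissible M A Y P b0 ?D W.policy (\<lambda>_. enat N) ?I"
    using I sel(1) by (intro W.admissible_fixed_time D) auto

  have step: "(\<integral>\<^sup>+y. ennreal (T.potential M \<eta> i (Suc t) (T.play t s y)) \<partial>P i (sel (fst s) (T.challenger t)))
      \<le> ennreal (T.potential M \<eta> i t s)"
    if i: "i \<in> {1..M}" and t: "t < N" and inv: "fst s \<in> {1..<T.challenger t}" for i t s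
  proof -
    obtain c k where s: "s = (c, k)"
      by force
    let ?d = "T.challenger t"
    let ?a = "sel c ?d"
    have "t div n < M - 1"
      using t by (simp add: N_def less_mult_imp_div_less)
    then have d: "?d \<le> M"
      by (simp add: T.challenger_def)
    have c: "1 \<le> c" "c < ?d" "c \<in> {1..M}" "?d \<in> {1..M}"
      using inv d by (auto simp: s)
    note Pa = P_space[OF _ sel(2)]
    have \<phi>a: "\<phi> ?a \<in> P c ?a \<rightarrow>\<^sub>M count_space {1..K}"
      using \<phi>[OF sel(2)] by (simp add: measurable_cong_sets[OF Pa(2)[OF c(3)] refl])
    have sets_eq: "sets (P c ?a) = sets (P ?d ?a)"
      using Pa(2) c by simp
    note test = threshold_test_moments[OF Pa(1)[OF c(3)] Pa(1)[OF c(4)] sets_eq \<phi>a \<open>\<eta> > 0\<close>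
        sel_l1[OF c(1,2) d, unfolded summary_law_def]]
    have moments: "(\<integral>\<^sup>+y. ennreal (exp (\<eta> * (of_bool (hit c ?d y) - thr c ?d))) \<partial>P c ?a) \<le> ennreal ?q"
      "(\<integral>\<^sup>+y. ennreal (exp (- \<eta> * (of_bool (hit c ?d y) - thr c ?d))) \<partial>P ?d ?a) \<le> ennreal ?q"
      unfolding hit_def thr_def B_def summary_law_def by (rule test)+
    have "Measurable.pred (P i ?a) (hit c ?d)"
      using hit by (simp add: measurable_cong_sets[OF Pa(2)[OF i] refl])
    then show ?thesis
      unfolding s fst_conv
    proof (rule T.nn_integral_potential_play_le[OF Pa(1)[OF i] _ c(2) d \<open>\<eta> > 0\<close>])
      \<comment> \<open>If the true index is the champion, responses follow \<open>P c\<close> and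
        the sign is 1; if it is the challenger, they follow \<open>P ?d\<close> and the sign is
        -1.\<close>
      assume "i \<in> {c, ?d}"
      then show "(\<integral>\<^sup>+y. ennreal (exp (T.side i c * \<eta> * (of_bool (hit c ?d y) - thr c ?d))) \<partial>P i ?a) \<le> ennreal ?q"
        using moments c(2) by (auto simp: T.side_def)
    qed
  qed

  have err: "emeasure (trajectory_law A Y (P i) W.policy)
      {h \<in> space (trajectory_law A Y (P i) W.policy). fst (W.memory N h) \<noteq> i} \<le> ennreal \<delta>" (is "emeasure ?T ?E \<le> _")
    if i: "i \<in> {1..M}" for i
  proof -
    have "sets ?T = sets (PiM UNIV (\<lambda>_. A \<Otimes>\<^sub>M Y))"
      by (rule trajectory_law(2)[OF P[OF i] W.is_policy])
    then have "?T \<rightarrow>\<^sub>M count_space UNIV = PiM UNIV (\<lambda>_. A \<Otimes>\<^sub>M Y) \<rightarrow>\<^sub>M count_space UNIV"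
      by (rule measurable_cong_sets) simp
    then have "W.memory N \<in> ?T \<rightarrow>\<^sub>M count_space UNIV"
      using W.measurable_memory[of N UNIV] by blast
    then have "Measurable.pred ?T (\<lambda>h. fst (W.memory N h) \<noteq> i)"
      by (rule measurable_compose) simp
    then have "emeasure ?T ?E = (\<integral>\<^sup>+h. indicator ?E h \<partial>?T)"
      by simp
    \<comment> \<open>A wrong final champion makes the potential 1; for the right one the indicator
      is 0.\<close>
    also have "\<dots> \<le> (\<integral>\<^sup>+h. ennreal (T.potential M \<eta> i N (W.memory N h)) \<partial>?T)"
    proof (rule nn_integral_mono)
      fix h
      show "indicator ?E h \<le> ennreal (T.potential M \<eta> i N (W.memory N h))"
        using T.potential_end[of M i "fst (W.memory N h)" \<eta> "snd (W.memory N h)"] i \<open>M \<ge> 2\<close>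
        by (auto simp: indicator_def N_def simp del: T.potential.simps)
    qed
    also have "\<dots> \<le> ennreal (T.potential M \<eta> i 0 (1, 0))"
      by (rule W.nn_integral_memory_le[OF P[OF i], where I="?valid", OF valid0])
        (erule T.play_champion, erule step[OF i], assumption)
    also have "\<dots> \<le> ennreal \<delta>"
      using T.potential_start[of M i \<eta> 0] i n(3) \<open>M \<ge> 2\<close> by (intro ennreal_leI) (simp del: T.potential.simps)
    finally show ?thesis .
  qed

  let ?L = "outcome_law M A Y P b0 W.policy"
  interpret L: prob_space ?L
    by (rule outcome_law(1)[OF P W.is_policy b0])
  let ?X = "{\<omega> \<in> space (outcome_space M A Y). ?I \<omega> \<noteq> fst \<omega>}"
  have "(\<lambda>\<omega>. W.memory N (snd \<omega>)) \<in> outcome_space M A Y \<rightarrow>\<^sub>M count_space UNIV"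
    unfolding outcome_space_def by (rule measurable_compose[OF measurable_snd W.measurable_memory]) simp
  then have "?I \<in> outcome_space M A Y \<rightarrow>\<^sub>M count_space UNIV"
    by (rule measurable_compose[where g=fst]) simp
  moreover have "Measurable.pred (outcome_space M A Y) (\<lambda>\<omega>. i \<noteq> fst \<omega>)" for i
    unfolding outcome_space_def by (rule measurable_compose[OF measurable_fst, where g="\<lambda>j. i \<noteq> j"]) simp
  ultimately have "Measurable.pred (outcome_space M A Y) (\<lambda>\<omega>. ?I \<omega> \<noteq> fst \<omega>)"
    by (rule measurable_compose_countable[rotated])
  then have X: "?X \<in> sets (outcome_space M A Y)"
    by simp
  have "emeasure ?L ?X = (\<Sum>i\<in>{1..M}. ennreal (b0 i) *
      emeasure (trajectory_law A Y (P i) W.policy) (Pair i -` ?X \<inter> space (trajectory_law A Y (P i) W.policy)))"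
    using \<open>M \<ge> 2\<close> by (intro emeasure_outcome_law P W.is_policy X) auto
  \<comment> \<open>The error bound holds conditionally on every index, so averaging over any prior
    preserves it.\<close>
  also have "\<dots> \<le> (\<Sum>i\<in>{1..M}. ennreal (b0 i) * ennreal \<delta>)"
  proof (intro sum_mono mult_left_mono)
    fix i assume i: "i \<in> {1..M}"
    have "Pair i -` ?X \<inter> space (trajectory_law A Y (P i) W.policy)
        = {h \<in> space (trajectory_law A Y (P i) W.policy). fst (W.memory N h) \<noteq> i}"
      using i sets_eq_imp_space_eq[OF trajectory_law(2)[OF P[OF i] W.is_policy]]
      by (auto simp: outcome_space_def space_pair_measure)
    then show "emeasure (trajectory_law A Y (P i) W.policy)
        (Pair i -` ?X \<inter> space (trajectory_law A Y (P i) W.policy)) \<le> ennreal \<delta>"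
      using err[OF i] by simp
  qed simp
  also have "\<dots> = ennreal (\<Sum>i\<in>{1..M}. b0 i) * ennreal \<delta>"
    using b0(1) by (subst sum_ennreal[symmetric]) (auto simp: sum_distrib_right intro: less_imp_le)
  finally have "emeasure ?L ?X \<le> ennreal \<delta>"
    unfolding b0(2) by simp
  then have "measure ?L ?X \<le> \<delta>"
    unfolding L.emeasure_eq_measure ennreal_le_iff[OF less_imp_le[OF \<open>0 < \<delta>\<close>]] .
  \<comment> \<open>The stopping time is constant, so its expectation is exactly
    \<open>(M - 1) * n\<close>.\<close>
  moreover have "(\<integral>\<^sup>+\<omega>. ennreal_of_enat (enat N) \<partial>?L)
      \<le> ennreal (real (M - 1) * real_of_int \<lceil>8 / \<eta>\<^sup>2 * ln (real (M - 1) / \<delta>)\<rceil>)"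
    unfolding n(2)[symmetric] nn_integral_const L.emeasure_space_1
    by (simp add: N_def ennreal_of_nat_eq_real_of_nat)
  ultimately show ?thesis
    by (rule inner_value_le[OF adm])
qed

end
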